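(* Let $m\ge 3$ be odd. Let $\Gamma$ be a graph with a vertex partition $\{C_1,\dots,C_m,D\}$, where the indices of the sets $C_i$ are read in $\mathbb{Z}/m\mathbb{Z}$, such that: (i) $|C_1|=\cdots=|C_m|=2$; write $C_i=\{v_{i1},v_{i2}\}$. (ii) For every vertex $v\in D$, the numbers of neighbours of $v$ in $C_1,\dots,C_m$ are all congruent modulo $2$. (iii) For all $i,j\in\mathbb{Z}/m\mathbb{Z}$ with $j\in\{i+1,\dots,i+\frac{m-1}{2}\}$, the edge set of the induced subgraph on $C_i\cup C_j$ is: - either $\{v_{i1}v_{j1},\,v_{i2}v_{j2}\}$ or $\{v_{i1}v_{j2},\,v_{i2}v_{j1}\}$, if $j\in\{i+1,\dots,i+\frac{m-3}{2}\}$; - either $\{v_{i1}v_{j1},\,v_{i1}v_{j2}\}$ or $\{v_{i2}v_{j1},\,v_{i2}v_{j2}\}$, if $j=i+\frac{m-1}{2}$. Let $\pi$ be the permutation of $C_1\cup\dots\cup C_m$ with $\pi(v_{ia})=v_{i-1,a}$ for all $i\in\mathbb{Z}/m\mathbb{Z}$ and $a\in\{1,2\}$. Construct a graph $\Gamma'$ from $\Gamma$ on the same vertex set as follows, leaving all other adjacencies unchanged. - For every $v\in D$ that has exactly one neighbour $w$ in each $C_i$, replace each such edge $\{v,w\}$ by $\{v,\pi(w)\}$. - For all $i,j\in\mathbb{Z}/m\mathbb{Z}$ with $j\in\{i+1,\dots,i+\frac{m-1}{2}\}$, simultaneously replace the induced subgraph on $C_i\cup C_j$ by the former induced subgraph on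 $C_{i+1}\cup C_{j+1}$ if $j\ne i+\frac{m-1}{2}$, and by the former induced subgraph on $C_i\cup C_{j+1}$ if $j=i+\frac{m-1}{2}$. Then $\Gamma'$ is $\mathbb{R}$-cospectral with $\Gamma$.
   Context: Graphs are finite, simple and loopless. Two graphs with adjacency matrices $A$ and $A'$ are $\mathbb{R}$-cospectral if $A+rJ$ and $A'+rJ$ have the same spectrum for every $r\in\mathbb{R}$, where $J$ is the all-ones matrix. "Replace the induced subgraph on $C_i\cup C_j$ by the former induced subgraph on $C_k\cup C_l$" means: in the new graph, $v_{ia}$ and $v_{jb}$ are adjacent if and only if $v_{ka}$ and $v_{lb}$ were adjacent in $\Gamma$ ($a,b\in\{1,2\}$); the sets $C_i$ themselves remain edgeless. *)

theory Defs
  imports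
    "Graph_Theory.Pair_Digraph"
    "Graph_Theory.Digraph_Component"
    "Jordan_Normal_Form.Char_Poly"
    "HOL-Library.Disjoint_Sets"
    "HOL-Number_Theory.Cong"
begin

text \<open>
  A finite simple graph is a \<^locale>\<open>pair_graph\<close>: every edge \<open>{x, y}\<close> is represented by the
  two arcs \<open>(x, y)\<close> and \<open>(y, x)\<close>.
\<close>

definition adjacency_mat :: "'a pair_pre_digraph \<Rightarrow> 'a list \<Rightarrow> real mat" where
  "adjacency_mat G vs =
     mat (length vs) (length vs) (\<lambda>(i, j). if (vs ! i, vs ! j) \<in> parcs G then 1 else 0)"

definition ones_mat :: "nat \<Rightarrow> real mat" where
  "ones_mat n = mat n n (\<lambda>_. 1)"

text \<open>All complex eigenvalues, with their algebraic multiplicities.\<close>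

definition spectrum_mset :: "real mat \<Rightarrow> complex multiset" where
  "spectrum_mset A = proots (char_poly (map_mat complex_of_real A))"

text \<open>
  The spectrum does not depend on how the vertices are enumerated; all enumerations of either
  vertex set are allowed.
\<close>

definition R_cospectral :: "'a pair_pre_digraph \<Rightarrow> 'b pair_pre_digraph \<Rightarrow> bool" where
  "R_cospectral G H \<longleftrightarrow>
     (\<forall>vs ws. distinct vs \<and> set vs = pverts G \<and> distinct ws \<and> set ws = pverts H \<longrightarrow>
        (\<forall>r::real. spectrum_mset (adjacency_mat G vs + r \<cdot>\<^sub>m ones_mat (length vs))
                 = spectrum_mset (adjacency_mat H ws + r \<cdot>\<^sub>m ones_mat (length ws))))"

text \<open>
  The index group \<open>\<int>/m\<int>\<close> is represented by the residues \<open>0, \<dots>, m - 1\<close>, and the two vertices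
  of the \<open>i\<close>-th cell are \<open>v i 1\<close> and \<open>v i 2\<close>.
\<close>

definition cell :: "(nat \<Rightarrow> nat \<Rightarrow> 'a) \<Rightarrow> nat \<Rightarrow> 'a set" where
  "cell v i = {v i 1, v i 2}"

definition cells :: "nat \<Rightarrow> (nat \<Rightarrow> nat \<Rightarrow> 'a) \<Rightarrow> 'a set" where
  "cells m v = (\<Union>i<m. cell v i)"

definition one_neighbour_vertices ::
  "nat \<Rightarrow> (nat \<Rightarrow> nat \<Rightarrow> 'a) \<Rightarrow> 'a set \<Rightarrow> 'a pair_pre_digraph \<Rightarrow> 'a set" where
  "one_neighbour_vertices m v D G = {x \<in> D. \<forall>i<m. card (parcs G `` {x} \<inter> cell v i) = 1}"

text \<open>
  First all adjacencies subject to replacement are deleted, then the new ones are inserted; the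
  latter are read off from the old graph, so that the replacements are simultaneous. The
  difference \<open>j - i\<close> is called \<open>d\<close>, and \<open>h = (m - 1) / 2\<close>.
\<close>

definition switched_graph ::
  "nat \<Rightarrow> (nat \<Rightarrow> nat \<Rightarrow> 'a) \<Rightarrow> 'a set \<Rightarrow> ('a \<Rightarrow> 'a) \<Rightarrow> 'a pair_pre_digraph \<Rightarrow> 'a pair_pre_digraph"
where
  "switched_graph m v D \<pi> G =
    (let h = (m - 1) div 2;
         S = one_neighbour_vertices m v D G
     in \<lparr> pverts = pverts G,
          parcs =
            (parcs G - symcl (S \<times> cells m v)
                     - (\<Union>i<m. \<Union>d\<in>{1..h}. (cell v i \<union> cell v ((i + d) mod m))
                                        \<times> (cell v i \<union> cell v ((i + d) mod m))))
            \<union> symcl {(x, \<pi> w) | x w. x \<in> S \<and> w \<in> cells m v \<and> (x, w) \<in> parcs G}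
            \<union> symcl {(v i a, v ((i + d) mod m) b) | i d a b.
                 i < m \<and> d \<in> {1..<h} \<and> a \<in> {1, 2} \<and> b \<in> {1, 2} \<and>
                 (v ((i + 1) mod m) a, v ((i + d + 1) mod m) b) \<in> parcs G}
            \<union> symcl {(v i a, v ((i + h) mod m) b) | i a b.
                 i < m \<and> a \<in> {1, 2} \<and> b \<in> {1, 2} \<and>
                 (v i a, v ((i + h + 1) mod m) b) \<in> parcs G} \<rparr>)"

end

(*
  Split R^cells into the vectors that are constant on every cell and those that are alternating
  (v i 1 and v i 2 get opposite values) on every cell. Let Q fix the former and the coordinates
  in D, and rotate the latter by one cell. Q is orthogonal and Q 1 = 1, so Q commutes with J, and
  it remains to see Q A = A' Q. Write the 2x2 block of A between the cells i and j in the basis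
  (1, 1), (1, -1). Its constant-constant entry is the same for all i \<noteq> j. A near block
  (|j - i| < h) has otherwise only an alternating-alternating entry, which Q moves to the block
  (i - 1, j - 1). A far block (j = i + h) has otherwise only an alternating-constant entry, which
  Q moves to (i - 1, j); since j + h = i - 1, this is again a far block, now read from j to i - 1.
  A vertex of D sees the cells either constantly, or with one neighbour in each of them, in which
  case Q shifts the alternating part of its row, as \<pi> does.
*)

theory Submission
  imports Defs
begin

text \<open>The vertex labels are 1 and 2; rewriting \<open>1\<close> to \<open>Suc 0\<close> would
  keep terms such as \<open>v i 1\<close> from matching.\<close>

declare One_nat_def [simp del]

section \<open>Similarity of matrices from an orthogonal intertwiner\<close>

lemma sum_nth_enumeration:
  assumes "distinct vs"
  shows "(\<Sum>l<length vs. f (vs ! l)) = sum f (set vs)"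
  using sum.reindex_bij_betw[OF bij_betw_nth[OF assms refl refl], of f] .

text \<open>The rows of \<open>Q\<close> are enumerated by \<open>ws\<close> and its columns by
  \<open>vs\<close>, so a single similarity also absorbs the change of enumeration. The matrix
  \<open>R\<close> is the transpose of \<open>Q\<close>, hence its inverse by orthogonality.\<close>

lemma char_poly_eq_of_intertwining:
  fixes f g q :: "'a \<Rightarrow> 'a \<Rightarrow> real"
  assumes vs: "distinct vs" "set vs = V" and ws: "distinct ws" "set ws = V"
    and orth: "\<And>x z. x \<in> V \<Longrightarrow> z \<in> V \<Longrightarrow> (\<Sum>y\<in>V. q x y * q z y) = (if x = z then 1 else 0)"
    and inter: "\<And>x z. x \<in> V \<Longrightarrow> z \<in> V \<Longrightarrow> (\<Sum>y\<in>V. q x y * f y z) = (\<Sum>y\<in>V. g x y * q y z)"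
  shows "char_poly (mat (length ws) (length ws) (\<lambda>(i, j). g (ws ! i) (ws ! j))) =
    char_poly (mat (length vs) (length vs) (\<lambda>(i, j). f (vs ! i) (vs ! j)))"
proof -
  define n where "n = length vs"
  have len: "length ws = n" "length vs = n"
    using vs ws by (auto simp: n_def simp flip: distinct_card)
  have sv: "(\<Sum>l<n. k (vs ! l)) = sum k V" for k :: "'a \<Rightarrow> real"
    using sum_nth_enumeration[OF vs(1)] vs(2) by (simp add: n_def)
  have sw: "(\<Sum>l<n. k (ws ! l)) = sum k V" for k :: "'a \<Rightarrow> real"
    using sum_nth_enumeration[OF ws(1)] ws(2) len by metis
  have mem: "vs ! i \<in> V" "ws ! i \<in> V" if "i < n" for i
    using that vs ws len nth_mem by metis+
  define Q where "Q = mat n n (\<lambda>(i, j). q (ws ! i) (vs ! j))"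
  define R where "R = mat n n (\<lambda>(i, j). q (ws ! j) (vs ! i))"
  define F where "F = mat n n (\<lambda>(i, j). f (vs ! i) (vs ! j))"
  define K where "K = mat n n (\<lambda>(i, j). g (ws ! i) (ws ! j))"
  have carr: "Q \<in> carrier_mat n n" "R \<in> carrier_mat n n" "F \<in> carrier_mat n n" "K \<in> carrier_mat n n"
    by (simp_all add: Q_def R_def F_def K_def)
  have QR: "Q * R = 1\<^sub>m n"
    by (rule eq_matI)
      (auto simp: Q_def R_def scalar_prod_def atLeast0LessThan sv[of "\<lambda>y. q _ y * q _ y"] orth mem nth_eq_iff_index_eq ws(1) len)
  have RQ: "R * Q = 1\<^sub>m n"
    using mat_mult_left_right_inverse[OF carr(1,2) QR] .
  have "Q * F = K * Q"
    by (rule eq_matI)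
      (auto simp: Q_def K_def F_def scalar_prod_def atLeast0LessThan
        sv[of "\<lambda>y. q _ y * f y _"] sw[of "\<lambda>y. g _ y * q y _"] inter mem)
  then have "K = Q * F * R"
    using carr QR by (simp add: assoc_mult_mat[of _ n n _ n _ n])
  then have "similar_mat K F"
    using carr QR RQ unfolding similar_mat_def similar_mat_wit_def Let_def
    by (intro exI[of _ Q] exI[of _ R]) simp
  then show ?thesis
    unfolding len using char_poly_similar by (simp add: F_def K_def)
qed

section \<open>Cells and their cyclic indexing\<close>

locale cell_partition =
  fixes m :: nat and v :: "nat \<Rightarrow> nat \<Rightarrow> 'a" and D :: "'a set"
  assumes cells_D_disjoint: "cells m v \<inter> D = {}"
    and cells_disjoint: "disjoint_family_on (cell v) {..<m}"
    and card_cell: "\<And>i. i < m \<Longrightarrow> card (cell v i) = 2"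
    and finite_D: "finite D"
begin

text \<open>In \<open>prv\<close>, adding \<open>m\<close> first keeps the natural subtraction from
  truncating at index 0; the same expression occurs in the hypothesis on \<pi>.\<close>

definition nxt :: "nat \<Rightarrow> nat" where "nxt i = (i + 1) mod m"

definition prv :: "nat \<Rightarrow> nat" where "prv i = (i + m - 1) mod m"

lemma nxt_less [simp]: "i < m \<Longrightarrow> nxt i < m" and prv_less [simp]: "i < m \<Longrightarrow> prv i < m"
  by (simp_all add: nxt_def prv_def)

lemma nxt_prv [simp]: "i < m \<Longrightarrow> nxt (prv i) = i" and prv_nxt [simp]: "i < m \<Longrightarrow> prv (nxt i) = i"
  by (auto simp: nxt_def prv_def mod_simps) (auto simp: mod_if)

lemma nxt_eq_iff: "i < m \<Longrightarrow> j < m \<Longrightarrow> nxt i = nxt j \<longleftrightarrow> i = j"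
  by (metis prv_nxt)

lemma nxt_eq_iff_prv: "i < m \<Longrightarrow> j < m \<Longrightarrow> j = nxt i \<longleftrightarrow> i = prv j"
  by (metis prv_nxt nxt_prv)

lemma v_eq_iff [simp]:
  assumes "i < m" "j < m" "a \<in> {1, 2}" "b \<in> {1, 2}"
  shows "v i a = v j b \<longleftrightarrow> i = j \<and> a = b"
proof
  assume eq: "v i a = v j b"
  have "v i a \<in> cell v i" "v j b \<in> cell v j"
    using assms by (auto simp: cell_def)
  then have "i = j"
    using eq cells_disjoint assms(1,2) by (auto simp: disjoint_family_on_def)
  moreover have "v i 1 \<noteq> v i 2"
    using card_cell[OF assms(1)] by (auto simp: cell_def)
  ultimately show "i = j \<and> a = b"
    using eq assms by auto
qed auto

lemma v_in_cell_iff [simp]: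
  "i < m \<Longrightarrow> j < m \<Longrightarrow> a \<in> {1, 2} \<Longrightarrow> v i a \<in> cell v j \<longleftrightarrow> i = j"
  by (auto simp: cell_def)

lemma v_in_cells [simp]: "i < m \<Longrightarrow> a \<in> {1, 2} \<Longrightarrow> v i a \<in> cells m v"
  by (auto simp: cells_def cell_def)

lemma v_notin_D [simp]: "i < m \<Longrightarrow> a \<in> {1, 2} \<Longrightarrow> v i a \<notin> D"
  using cells_D_disjoint v_in_cells by blast

lemma cellsE:
  assumes "x \<in> cells m v"
  obtains i a where "i < m" "a \<in> {1, 2}" "x = v i a"
  using assms by (auto simp: cells_def cell_def)

lemma vertex_cases [consumes 1, case_names cell outside]:
  assumes "x \<in> cells m v \<union> D"
  obtains i a where "i < m" "a \<in> {1, 2}" "x = v i a" | "x \<in> D"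
  using assms by (auto elim: cellsE)

lemma finite_cells: "finite (cells m v)"
  by (auto simp: cells_def cell_def)

lemma sum_vertices:
  "(\<Sum>y\<in>cells m v \<union> D. f y) = (\<Sum>i<m. f (v i 1) + f (v i 2)) + (\<Sum>y\<in>D. (f y :: real))"
proof -
  have "(\<Sum>y\<in>cells m v. f y) = (\<Sum>i<m. \<Sum>y\<in>cell v i. f y)"
    unfolding cells_def using cells_disjoint
    by (intro sum.UNION_disjoint) (auto simp: disjoint_family_on_def cell_def)
  also have "\<dots> = (\<Sum>i<m. f (v i 1) + f (v i 2))"
    by (intro sum.cong) (auto simp: cell_def)
  finally show ?thesis
    using cells_D_disjoint finite_D finite_cells by (simp add: sum.union_disjoint)
qed

section \<open>The orthogonal matrix rotating alternating vectors\<close>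

text \<open>The value at \<open>v i a\<close> of the alternating vector
  \<open>chi i\<close>.\<close>

definition sg :: "nat \<Rightarrow> real" where "sg a = (if a = 1 then 1 else -1)"

definition chi :: "nat \<Rightarrow> 'a \<Rightarrow> real" where
  "chi i x = of_bool (x = v i 1) - of_bool (x = v i 2)"

text \<open>
  The orthogonal matrix \<open>Q\<close>: the two sums project onto the constant part of each cell,
  and send the alternating part of cell \<open>i + 1\<close> to cell \<open>i\<close>.
\<close>

definition rot :: "'a \<Rightarrow> 'a \<Rightarrow> real" where
  "rot x y = of_bool (x \<in> D \<and> x = y)
     + (\<Sum>i<m. of_bool (x \<in> cell v i) * of_bool (y \<in> cell v i)) / 2
     + (\<Sum>i<m. chi i x * chi (nxt i) y) / 2"

lemma sg_simps [simp]: "sg 1 = 1" "sg 2 = -1"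
  by (simp_all add: sg_def)

lemma chi_v: "i < m \<Longrightarrow> j < m \<Longrightarrow> a \<in> {1, 2} \<Longrightarrow> chi j (v i a) = sg a * of_bool (i = j)"
  by (auto simp: chi_def)

lemma D_notin: "x \<in> D \<Longrightarrow> i < m \<Longrightarrow> x \<notin> cell v i"
  by (auto simp: cell_def)

lemma chi_D: "x \<in> D \<Longrightarrow> i < m \<Longrightarrow> chi i x = 0"
  by (auto simp: chi_def)

lemma rot_D [simp]:
  "x \<in> D \<Longrightarrow> rot x y = of_bool (x = y)"
  "y \<in> D \<Longrightarrow> rot x y = of_bool (x = y)"
  by (auto simp: rot_def D_notin chi_D)

lemma rot_v:
  assumes "i < m" "j < m" "a \<in> {1, 2}" "b \<in> {1, 2}"
  shows "rot (v i a) (v j b) = of_bool (j = i) / 2 + sg a * sg b * of_bool (j = nxt i) / 2"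
proof -
  have 1: "(\<Sum>k<m. of_bool (v i a \<in> cell v k) * of_bool (v j b \<in> cell v k)) = (of_bool (j = i) :: real)"
  proof -
    have "(\<Sum>k<m. of_bool (v i a \<in> cell v k) * of_bool (v j b \<in> cell v k)) =
       (\<Sum>k<m. if k = i then of_bool (j = i) else (0::real))"
      using assms by (intro sum.cong) auto
    then show ?thesis using assms by simp
  qed
  have 2: "(\<Sum>k<m. chi k (v i a) * chi (nxt k) (v j b)) = sg a * sg b * of_bool (j = nxt i)"
  proof -
    have "(\<Sum>k<m. chi k (v i a) * chi (nxt k) (v j b)) =
       (\<Sum>k<m. if k = i then sg a * sg b * of_bool (j = nxt i) else 0)"
      using assms by (intro sum.cong refl) (simp add: chi_v)
    then show ?thesis using assms by simp
  qed
  show ?thesis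
    unfolding rot_def 1 2 using assms by simp
qed

lemma sum_rot_D:
  assumes "x \<in> D"
  shows "(\<Sum>y\<in>cells m v \<union> D. rot x y * f y) = f x" "(\<Sum>y\<in>cells m v \<union> D. f y * rot y x) = f x"
  using assms finite_cells finite_D
  by (simp_all add: of_bool_def if_distrib[of "\<lambda>t. t * _"] if_distrib[of "\<lambda>t. _ * t"] cong: if_cong)

lemma sum_two_delta:
  fixes p q :: "nat \<Rightarrow> real"
  assumes "i < m" "j < m"
  shows "(\<Sum>k<m. p k * of_bool (k = i) + q k * of_bool (k = j)) = p i + q j"
  using assms by (simp add: sum.distrib of_bool_def if_distrib[of "\<lambda>t. _ * t"] cong: if_cong)

text \<open>Row \<open>v i a\<close> is supported on two cells: the constant part is averaged over
  cell \<open>i\<close>, the alternating part is fetched from cell \<open>nxt i\<close>.\<close>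

lemma sum_rot_row:
  assumes "i < m" "a \<in> {1, 2}"
  shows "(\<Sum>y\<in>cells m v \<union> D. rot (v i a) y * f y) =
    (f (v i 1) + f (v i 2)) / 2 + sg a * (f (v (nxt i) 1) - f (v (nxt i) 2)) / 2"
proof -
  have "(\<Sum>y\<in>D. rot (v i a) y * f y) = 0"
    using assms by (intro sum.neutral) auto
  moreover have "(\<Sum>k<m. rot (v i a) (v k 1) * f (v k 1) + rot (v i a) (v k 2) * f (v k 2)) =
    (\<Sum>k<m. (f (v k 1) + f (v k 2)) / 2 * of_bool (k = i)
        + sg a * (f (v k 1) - f (v k 2)) / 2 * of_bool (k = nxt i))"
    using assms by (intro sum.cong) (simp_all add: rot_v field_simps)
  ultimately show ?thesis
    unfolding sum_vertices using assms by (simp only: sum_two_delta nxt_less add_0_right)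
qed

text \<open>Read by columns, the rotation goes the other way: an alternating part in cell
  \<open>j\<close> is delivered to cell \<open>prv j\<close>.\<close>

lemma sum_rot_col:
  assumes "j < m" "b \<in> {1, 2}"
  shows "(\<Sum>y\<in>cells m v \<union> D. f y * rot y (v j b)) =
    (f (v j 1) + f (v j 2)) / 2 + sg b * (f (v (prv j) 1) - f (v (prv j) 2)) / 2"
proof -
  have "(\<Sum>y\<in>D. f y * rot y (v j b)) = 0"
    using assms by (intro sum.neutral) auto
  moreover have "(\<Sum>k<m. f (v k 1) * rot (v k 1) (v j b) + f (v k 2) * rot (v k 2) (v j b)) =
    (\<Sum>k<m. (f (v k 1) + f (v k 2)) / 2 * of_bool (k = j)
        + sg b * (f (v k 1) - f (v k 2)) / 2 * of_bool (k = prv j))"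
    using assms by (intro sum.cong) (auto simp: rot_v nxt_eq_iff_prv field_simps)
  ultimately show ?thesis
    unfolding sum_vertices using assms by (simp only: sum_two_delta prv_less add_0_right)
qed

text \<open>Rows of different cells have orthogonal constant parts and, \<open>nxt\<close> being
  injective, orthogonal alternating parts. For two rows of one cell the two contributions are 1/2
  each in absolute value; they add up if the labels agree and cancel otherwise.\<close>

lemma rot_orthogonal:
  assumes "x \<in> cells m v \<union> D" "z \<in> cells m v \<union> D"
  shows "(\<Sum>y\<in>cells m v \<union> D. rot x y * rot z y) = (if x = z then 1 else 0)"
  using assms(1)
proof (cases rule: vertex_cases)
  case (cell i a)
  show ?thesis using assms(2)
  proof (cases rule: vertex_cases)
    case (cell k c)
    with \<open>i < m\<close> \<open>a \<in> {1, 2}\<close> \<open>x = v i a\<close> show ?thesis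
      by (auto simp: sum_rot_row rot_v nxt_eq_iff sg_def)
  next
    case outside
    with cell show ?thesis by (auto simp: sum_rot_row)
  qed
next
  case outside
  show ?thesis
    unfolding sum_rot_D(1)[OF outside, of "rot z"] using outside by auto
qed

text \<open>Together with the column sums below, this makes the matrix commute with J, which settles
  the term rJ for every r.\<close>

lemma rot_row_sum: "x \<in> cells m v \<union> D \<Longrightarrow> (\<Sum>y\<in>cells m v \<union> D. rot x y) = 1"
  by (cases x rule: vertex_cases)
    (use sum_rot_row[of _ _ "\<lambda>_. 1"] sum_rot_D(1)[of _ "\<lambda>_. 1"] in auto)

lemma rot_col_sum: "z \<in> cells m v \<union> D \<Longrightarrow> (\<Sum>y\<in>cells m v \<union> D. rot y z) = 1"
  by (cases z rule: vertex_cases)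
    (use sum_rot_col[of _ _ "\<lambda>_. 1"] sum_rot_D(2)[of _ "\<lambda>_. 1"] in auto)

section \<open>Blocks between cells and the intertwining criterion\<close>

text \<open>
  Up to scaling, the entries of the \<open>2 \<times> 2\<close> block of \<open>f\<close> between two cells in the basis
  \<open>(1, 1), (1, -1)\<close>. For symmetric \<open>f\<close> the missing fourth entry is \<open>alt_row f j i\<close>.
\<close>

definition total :: "('a \<Rightarrow> 'a \<Rightarrow> real) \<Rightarrow> nat \<Rightarrow> nat \<Rightarrow> real" where
  "total f i j = f (v i 1) (v j 1) + f (v i 1) (v j 2) + f (v i 2) (v j 1) + f (v i 2) (v j 2)"

definition alt_row :: "('a \<Rightarrow> 'a \<Rightarrow> real) \<Rightarrow> nat \<Rightarrow> nat \<Rightarrow> real" where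
  "alt_row f i j = f (v i 1) (v j 1) + f (v i 1) (v j 2) - f (v i 2) (v j 1) - f (v i 2) (v j 2)"

definition alt_both :: "('a \<Rightarrow> 'a \<Rightarrow> real) \<Rightarrow> nat \<Rightarrow> nat \<Rightarrow> real" where
  "alt_both f i j = f (v i 1) (v j 1) - f (v i 1) (v j 2) - f (v i 2) (v j 1) + f (v i 2) (v j 2)"

text \<open>Both products are expanded in the constant and alternating parts of the two indices.
  Multiplying by \<open>rot\<close> on the left moves the alternating part of the row index, on the
  right that of the column index, so the identity splits into one condition for each block entry.
  The missing fourth entry is covered by symmetry.\<close>

lemma rot_intertwines:
  assumes sym: "\<And>x y. f x y = f y x" "\<And>x y. g x y = g y x"
    and total: "\<And>i j. i < m \<Longrightarrow> j < m \<Longrightarrow> total g i j = total f i j"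
    and row: "\<And>i j. i < m \<Longrightarrow> j < m \<Longrightarrow> alt_row g i j = alt_row f (nxt i) j"
    and both: "\<And>i j. i < m \<Longrightarrow> j < m \<Longrightarrow> alt_both g i j = alt_both f (nxt i) (nxt j)"
    and D: "\<And>x y. x \<in> D \<Longrightarrow> y \<in> D \<Longrightarrow> g x y = f x y"
    and D_total: "\<And>x i. x \<in> D \<Longrightarrow> i < m \<Longrightarrow> g x (v i 1) + g x (v i 2) = f x (v i 1) + f x (v i 2)"
    and D_alt: "\<And>x i. x \<in> D \<Longrightarrow> i < m \<Longrightarrow>
      g x (v i 1) - g x (v i 2) = f x (v (nxt i) 1) - f x (v (nxt i) 2)"
    and x: "x \<in> cells m v \<union> D" and z: "z \<in> cells m v \<union> D"
  shows "(\<Sum>y\<in>cells m v \<union> D. rot x y * f y z) = (\<Sum>y\<in>cells m v \<union> D. g x y * rot y z)"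
  using x
proof (cases rule: vertex_cases)
  case (cell i a)
  note xi = this
  show ?thesis using z
  proof (cases rule: vertex_cases)
    case (cell j b)
    \<comment> \<open>The right product reads \<open>g\<close> at cell \<open>prv j\<close>, so the
      hypotheses are taken there and \<open>nxt (prv j)\<close> collapses to
      \<open>j\<close>.\<close>
    have R: "alt_row g (prv j) i = alt_row f j i" and B: "alt_both g i (prv j) = alt_both f (nxt i) j"
      using row[of "prv j" i] both[of i "prv j"] xi cell by simp_all
    show ?thesis
      using R B total[of i j] row[of i j] xi cell
        sym[of "v i 1"] sym[of "v i 2"]
      unfolding xi(3) cell(3) sum_rot_row[OF xi(1,2)] sum_rot_col[OF cell(1,2)]
      by (auto simp: total_def alt_row_def alt_both_def field_simps)
  next
    case outside
    show ?thesis
      using D_total[OF outside xi(1)] D_alt[OF outside xi(1)] xi sym[of z]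
      unfolding xi(3) sum_rot_row[OF xi(1,2)] sum_rot_D(2)[OF outside]
      by (auto simp: field_simps)
  qed
next
  case outside
  note xD = this
  show ?thesis using z
  proof (cases rule: vertex_cases)
    case (cell j b)
    show ?thesis
      using D_total[OF xD cell(1)] D_alt[of x "prv j"] xD cell
      unfolding cell(3) sum_rot_col[OF cell(1,2)] sum_rot_D(1)[OF xD]
      by (auto simp: field_simps)
  next
    case outside
    show ?thesis
      unfolding sum_rot_D(1)[OF xD] sum_rot_D(2)[OF outside] using D[OF xD outside] by simp
  qed
qed

end

section \<open>The hypotheses on the graph and adjacency between its cells\<close>

lemma symcl_iff: "(x, y) \<in> symcl R \<longleftrightarrow> (x, y) \<in> R \<or> (y, x) \<in> R"
  by (auto simp: symcl_def)

text \<open>With m = 2h + 1 the range 1, ..., (m - 3)/2 becomes \<open>{1..<h}\<close>, so no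
  division remains.\<close>

locale odd_switching = cell_partition m v D
  for m :: nat and v :: "nat \<Rightarrow> nat \<Rightarrow> 'a" and D :: "'a set" +
  fixes G :: "'a pair_pre_digraph" and \<pi> :: "'a \<Rightarrow> 'a" and h :: nat
  assumes h_pos: "h \<ge> 1" and m_eq: "m = 2 * h + 1"
    and pair_graph_G: "pair_graph G"
    and pverts_G: "pverts G = cells m v \<union> D"
    and parity: "\<And>x i j. x \<in> D \<Longrightarrow> i < m \<Longrightarrow> j < m \<Longrightarrow>
      [card (parcs G `` {x} \<inter> cell v i) = card (parcs G `` {x} \<inter> cell v j)] (mod 2)"
    and near_arcs: "\<And>i d j. i < m \<Longrightarrow> d \<in> {1..<h} \<Longrightarrow> j = (i + d) mod m \<Longrightarrow>
      arcs (with_proj G \<restriction> (cell v i \<union> cell v j)) = symcl {(v i 1, v j 1), (v i 2, v j 2)} \<or>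
      arcs (with_proj G \<restriction> (cell v i \<union> cell v j)) = symcl {(v i 1, v j 2), (v i 2, v j 1)}"
    and far_arcs: "\<And>i j. i < m \<Longrightarrow> j = (i + h) mod m \<Longrightarrow>
      arcs (with_proj G \<restriction> (cell v i \<union> cell v j)) = symcl {(v i 1, v j 1), (v i 1, v j 2)} \<or>
      arcs (with_proj G \<restriction> (cell v i \<union> cell v j)) = symcl {(v i 2, v j 1), (v i 2, v j 2)}"
    and perm: "\<And>i a. i < m \<Longrightarrow> a \<in> {1, 2} \<Longrightarrow> \<pi> (v i a) = v ((i + m - 1) mod m) a"
begin

definition adj :: "'a \<Rightarrow> 'a \<Rightarrow> bool" where "adj x y \<longleftrightarrow> (x, y) \<in> parcs G"

lemma adj_sym: "adj x y \<longleftrightarrow> adj y x"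
  using pair_graph_G pair_sym_digraph.arcs_symmetric[of G]
  unfolding adj_def pair_graph_def pair_pseudo_graph_def by blast

lemma adj_verts: "adj x y \<Longrightarrow> x \<in> cells m v \<union> D" "adj x y \<Longrightarrow> y \<in> cells m v \<union> D"
proof -
  interpret pair_graph G by (rule pair_graph_G)
  show "adj x y \<Longrightarrow> x \<in> cells m v \<union> D" "adj x y \<Longrightarrow> y \<in> cells m v \<union> D"
    using arc_fst_in_verts[of "(x, y)"] arc_snd_in_verts[of "(x, y)"] pverts_G
    by (auto simp: adj_def)
qed

lemma adj_irrefl: "\<not> adj x x"
proof -
  interpret pair_graph G by (rule pair_graph_G)
  show ?thesis using pair_no_loops[of "(x, x)"] by (auto simp: adj_def)
qed

text \<open>The residue of j - i modulo \<open>m\<close>; every pair of cells is classified by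
  it.\<close>

definition dif :: "nat \<Rightarrow> nat \<Rightarrow> nat" where "dif i j = (j + m - i) mod m"

lemma m_pos: "0 < m" using m_eq by simp

lemma dif_less: "dif i j < m" using m_pos by (simp add: dif_def)

lemma add_dif: "i < m \<Longrightarrow> j < m \<Longrightarrow> (i + dif i j) mod m = j"
  by (simp add: dif_def mod_simps)

lemma dif_add: "i < m \<Longrightarrow> d < m \<Longrightarrow> dif i ((i + d) mod m) = d"
  by (auto simp: dif_def mod_if)

lemma dif_refl [simp]: "dif i i = 0" using m_pos by (simp add: dif_def)

lemma dif_eq_0_iff: "i < m \<Longrightarrow> j < m \<Longrightarrow> dif i j = 0 \<longleftrightarrow> i = j"
  using add_dif[of i j] by auto

lemma dif_swap: "i < m \<Longrightarrow> j < m \<Longrightarrow> i \<noteq> j \<Longrightarrow> dif j i = m - dif i j"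
  by (auto simp: dif_def mod_if)

lemma dif_nxt_nxt: "i < m \<Longrightarrow> j < m \<Longrightarrow> dif (nxt i) (nxt j) = dif i j"
  by (auto simp: dif_def nxt_def mod_if)

lemma dif_nxt_left: "i < m \<Longrightarrow> j < m \<Longrightarrow> dif (nxt i) j = (if i = j then m - 1 else dif i j - 1)"
  by (auto simp: dif_def nxt_def mod_if)

lemma dif_nxt_right: "i < m \<Longrightarrow> j < m \<Longrightarrow> dif i (nxt j) = (if dif i j = m - 1 then 0 else dif i j + 1)"
  by (auto simp: dif_def nxt_def mod_if split: if_splits)

lemma induced_arcs: "arcs (with_proj G \<restriction> X) = {(x, y). adj x y \<and> x \<in> X \<and> y \<in> X}"
  by (auto simp: adj_def)

lemma near_adj:
  assumes "i < m" "j < m" "dif i j \<in> {1..<h}"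
  shows "(\<forall>a\<in>{1, 2}. \<forall>b\<in>{1, 2}. adj (v i a) (v j b) \<longleftrightarrow> a = b) \<or>
    (\<forall>a\<in>{1, 2}. \<forall>b\<in>{1, 2}. adj (v i a) (v j b) \<longleftrightarrow> a \<noteq> b)"
proof -
  have ne: "i \<noteq> j" using assms by auto
  have *: "adj (v i a) (v j b) \<longleftrightarrow> (v i a, v j b) \<in> arcs (with_proj G \<restriction> (cell v i \<union> cell v j))"
    if "a \<in> {1, 2}" "b \<in> {1, 2}" for a b
    unfolding induced_arcs using that assms by simp
  show ?thesis
    using near_arcs[OF assms(1,3) add_dif[OF assms(1,2), symmetric]]
  proof (elim disjE, goal_cases)
    case 1
    show ?thesis
      by (rule disjI1, intro ballI, unfold *) (unfold 1 symcl_iff, use assms ne in auto)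
  next
    case 2
    show ?thesis
      by (rule disjI2, intro ballI, unfold *) (unfold 2 symcl_iff, use assms ne in auto)
  qed
qed

text \<open>Here the direction matters: all edges of a far block leave one vertex
  \<open>v i c\<close> of the first cell, so adjacency depends on the label in cell \<open>i\<close>
  only.\<close>

lemma far_adj:
  assumes "i < m" "j < m" "dif i j = h"
  shows "\<exists>c\<in>{1, 2}. \<forall>a\<in>{1, 2}. \<forall>b\<in>{1, 2}. adj (v i a) (v j b) \<longleftrightarrow> a = c"
proof -
  have ne: "i \<noteq> j" using assms h_pos by auto
  have *: "adj (v i a) (v j b) \<longleftrightarrow> (v i a, v j b) \<in> arcs (with_proj G \<restriction> (cell v i \<union> cell v j))"
    if "a \<in> {1, 2}" "b \<in> {1, 2}" for a b
    unfolding induced_arcs using that assms by simp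
  have j: "j = (i + h) mod m" using add_dif[OF assms(1,2)] assms(3) by simp
  show ?thesis
    using far_arcs[OF assms(1) j]
  proof (elim disjE, goal_cases)
    case 1
    show ?thesis
      by (rule bexI[of _ 1], intro ballI, unfold *) (unfold 1 symcl_iff, use assms ne in auto)
  next
    case 2
    show ?thesis
      by (rule bexI[of _ 2], intro ballI, unfold *) (unfold 2 symcl_iff, use assms ne in auto)
  qed
qed

text \<open>An edge inside a cell would appear in the subgraph induced on this cell and another one,
  whose prescribed edges all join different cells.\<close>

lemma cell_edgeless:
  assumes "i < m" "a \<in> {1, 2}" "b \<in> {1, 2}"
  shows "\<not> adj (v i a) (v i b)"
proof
  assume "adj (v i a) (v i b)"
  \<comment> \<open>The far cell serves as the other one because it exists even for h = 1, when
    there are no near pairs.\<close>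
  define j where "j = (i + h) mod m"
  have "dif i j = h" "j < m"
    using assms m_eq dif_add[of i h] by (simp_all add: j_def)
  then have j: "j < m" "i \<noteq> j"
    using h_pos by auto
  have *: "(v i a, v i b) \<in> arcs (with_proj G \<restriction> (cell v i \<union> cell v j))"
    unfolding induced_arcs using \<open>adj _ _\<close> assms by simp
  show False
    using far_arcs[OF assms(1) j_def]
  proof (elim disjE, goal_cases)
    case 1
    show ?case using *[unfolded 1 symcl_iff] assms j by auto
  next
    case 2
    show ?case using *[unfolded 2 symcl_iff] assms j by auto
  qed
qed

section \<open>Adjacency in the switched graph\<close>

definition H :: "'a pair_pre_digraph" where "H = switched_graph m v D \<pi> G"

definition S :: "'a set" where "S = one_neighbour_vertices m v D G"

definition adj' :: "'a \<Rightarrow> 'a \<Rightarrow> bool" where "adj' x y \<longleftrightarrow> (x, y) \<in> parcs H"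

lemma S_subset: "S \<subseteq> D" by (auto simp: S_def one_neighbour_vertices_def)

lemma half: "(m - 1) div 2 = h" using m_eq by simp

definition cell_pairs :: "('a \<times> 'a) set" where
  "cell_pairs = (\<Union>i<m. \<Union>d\<in>{1..h}.
     (cell v i \<union> cell v ((i + d) mod m)) \<times> (cell v i \<union> cell v ((i + d) mod m)))"

definition new_D :: "('a \<times> 'a) set" where
  "new_D = {(x, \<pi> w) | x w. x \<in> S \<and> w \<in> cells m v \<and> (x, w) \<in> parcs G}"

definition new_near :: "('a \<times> 'a) set" where
  "new_near = {(v i a, v ((i + d) mod m) b) | i d a b.
     i < m \<and> d \<in> {1..<h} \<and> a \<in> {1, 2} \<and> b \<in> {1, 2} \<and>
     (v ((i + 1) mod m) a, v ((i + d + 1) mod m) b) \<in> parcs G}"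

definition new_far :: "('a \<times> 'a) set" where
  "new_far = {(v i a, v ((i + h) mod m) b) | i a b.
     i < m \<and> a \<in> {1, 2} \<and> b \<in> {1, 2} \<and> (v i a, v ((i + h + 1) mod m) b) \<in> parcs G}"

lemma parcs_H:
  "parcs H = (parcs G - symcl (S \<times> cells m v) - cell_pairs)
     \<union> symcl new_D \<union> symcl new_near \<union> symcl new_far"
  by (simp add: H_def switched_graph_def Let_def half S_def cell_pairs_def new_D_def new_near_def
      new_far_def)

lemma adj'_iff:
  "adj' x y \<longleftrightarrow>
    adj x y \<and> \<not> (x \<in> S \<and> y \<in> cells m v) \<and> \<not> (y \<in> S \<and> x \<in> cells m v) \<and> (x, y) \<notin> cell_pairs
    \<or> (x, y) \<in> new_D \<or> (y, x) \<in> new_D \<or> (x, y) \<in> new_near \<or> (y, x) \<in> new_near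
    \<or> (x, y) \<in> new_far \<or> (y, x) \<in> new_far"
  unfolding adj'_def parcs_H adj_def by (auto simp: symcl_iff)

lemma cell_pairs_sym: "(x, y) \<in> cell_pairs \<longleftrightarrow> (y, x) \<in> cell_pairs"
  by (auto simp: cell_pairs_def)

lemma pverts_H: "pverts H = cells m v \<union> D"
  by (simp add: H_def switched_graph_def Let_def pverts_G)

lemma adj'_sym: "adj' x y \<longleftrightarrow> adj' y x"
  unfolding adj'_iff adj_sym[of x y] cell_pairs_sym[of x y] by blast

lemma nxt_add: "(i + d + 1) mod m = nxt ((i + d) mod m)"
  by (simp add: nxt_def mod_simps)

text \<open>Since the cells are disjoint and d < m, the parameters \<open>i\<close>,
  \<open>d\<close>, \<open>a\<close>, \<open>b\<close> can be recovered from the two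
  vertices.\<close>

lemma in_near_iff:
  assumes "i < m" "j < m" "a \<in> {1, 2}" "b \<in> {1, 2}"
  shows "(v i a, v j b) \<in> new_near \<longleftrightarrow> dif i j \<in> {1..<h} \<and> adj (v (nxt i) a) (v (nxt j) b)"
    (is "?L \<longleftrightarrow> ?R")
proof
  assume ?L
  then obtain i' d a' b' where *: "v i a = v i' a'" "v j b = v ((i' + d) mod m) b'"
    "i' < m" "d \<in> {1..<h}" "a' \<in> {1, 2}" "b' \<in> {1, 2}"
    "(v ((i' + 1) mod m) a', v ((i' + d + 1) mod m) b') \<in> parcs G"
    unfolding new_near_def by blast
  have "(i' + d) mod m < m" using m_pos by simp
  with * assms have eqs: "i' = i" "a' = a" "j = (i' + d) mod m" "b' = b" by auto
  have "d < m" using * m_eq by simp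
  then have "dif i j = d" using eqs dif_add[of i d] assms by simp
  with * eqs show ?R
    unfolding nxt_add by (simp add: nxt_def adj_def)
next
  assume ?R
  moreover define d where "d = dif i j"
  ultimately have "j = (i + d) mod m" "d \<in> {1..<h}"
    "(v ((i + 1) mod m) a, v ((i + d + 1) mod m) b) \<in> parcs G"
    using assms add_dif[of i j] by (simp_all add: nxt_add adj_def) (simp add: nxt_def)
  then show ?L
    using assms unfolding new_near_def by blast
qed

lemma in_far_iff:
  assumes "i < m" "j < m" "a \<in> {1, 2}" "b \<in> {1, 2}"
  shows "(v i a, v j b) \<in> new_far \<longleftrightarrow> dif i j = h \<and> adj (v i a) (v (nxt j) b)"
    (is "?L \<longleftrightarrow> ?R")
proof
  assume ?L
  then obtain i' a' b' where *: "v i a = v i' a'" "v j b = v ((i' + h) mod m) b'"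
    "i' < m" "a' \<in> {1, 2}" "b' \<in> {1, 2}" "(v i' a', v ((i' + h + 1) mod m) b') \<in> parcs G"
    unfolding new_far_def by blast
  have "(i' + h) mod m < m" using m_pos by simp
  with * assms have eqs: "i' = i" "a' = a" "j = (i' + h) mod m" "b' = b" by auto
  have "h < m" using m_eq by simp
  then have "dif i j = h" using eqs dif_add[of i h] assms by simp
  with * eqs show ?R
    unfolding nxt_add by (simp add: adj_def)
next
  assume ?R
  then have "j = (i + h) mod m" "(v i a, v ((i + h + 1) mod m) b) \<in> parcs G"
    using assms add_dif[of i j] by (simp_all add: nxt_add adj_def)
  then show ?L
    using assms unfolding new_far_def by blast
qed

text \<open>The differences j - i and i - j add up to 2h + 1, so one of them is at most h. Hence
  every old edge between different cells is deleted.\<close>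

lemma in_cell_pairs:
  assumes "i < m" "j < m" "i \<noteq> j" "a \<in> {1, 2}" "b \<in> {1, 2}"
  shows "(v i a, v j b) \<in> cell_pairs"
proof -
  have *: "(v i a, v j b) \<in> cell_pairs"
    if "i < m" "j < m" "dif i j \<in> {1..h}" "a \<in> {1, 2}" "b \<in> {1, 2}" for i j a b
    unfolding cell_pairs_def using that add_dif[of i j]
    by (intro UN_I[of i] UN_I[of "dif i j"]) auto
  show ?thesis
  proof (cases "dif i j \<le> h")
    case True
    then have "dif i j \<in> {1..h}" using assms dif_eq_0_iff[of i j] by auto
    then show ?thesis using * assms by blast
  next
    case False
    then have "dif j i \<in> {1..h}"
      using dif_swap[OF assms(1-3)] m_eq dif_less[of i j] unfolding atLeastAtMost_iff by linarith
    then show ?thesis using *[of j i b a] assms cell_pairs_sym by blast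
  qed
qed

text \<open>Old edges between cells are gone and cells were edgeless, so only inserted edges remain;
  those at vertices of \<open>S\<close> have an end in \<open>D\<close>.\<close>

lemma adj'_cells_iff:
  assumes "i < m" "j < m" "a \<in> {1, 2}" "b \<in> {1, 2}"
  shows "adj' (v i a) (v j b) \<longleftrightarrow>
    dif i j \<in> {1..<h} \<and> adj (v (nxt i) a) (v (nxt j) b) \<or>
    dif j i \<in> {1..<h} \<and> adj (v (nxt j) b) (v (nxt i) a) \<or>
    dif i j = h \<and> adj (v i a) (v (nxt j) b) \<or>
    dif j i = h \<and> adj (v j b) (v (nxt i) a)"
proof -
  have "\<not> (adj (v i a) (v j b) \<and> (v i a, v j b) \<notin> cell_pairs)"
    using in_cell_pairs[of i j a b] cell_edgeless[of i a b] assms by (cases "i = j") blast+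
  moreover have "v i a \<notin> S" "v j b \<notin> S"
    using S_subset assms v_notin_D by blast+
  then have "(v i a, v j b) \<notin> new_D" "(v j b, v i a) \<notin> new_D"
    by (auto simp: new_D_def)
  ultimately show ?thesis
    unfolding adj'_iff in_near_iff[OF assms] in_near_iff[OF assms(2,1,4,3)]
      in_far_iff[OF assms] in_far_iff[OF assms(2,1,4,3)]
    by blast
qed

text \<open>This makes the four alternatives of \<open>adj'_cells_iff\<close> mutually exclusive up
  to the obvious choice, so a new block comes from one old block only.\<close>

lemma dif_swap_gt:
  assumes "i < m" "j < m" "dif i j \<in> {1..h}"
  shows "dif j i > h"
proof -
  have "i \<noteq> j" using assms by auto
  then show ?thesis
    using dif_swap[OF assms(1,2)] assms(3) m_eq unfolding atLeastAtMost_iff by linarith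
qed

lemma adj'_near:
  assumes "i < m" "j < m" "a \<in> {1, 2}" "b \<in> {1, 2}" "dif i j \<in> {1..<h}"
  shows "adj' (v i a) (v j b) \<longleftrightarrow> adj (v (nxt i) a) (v (nxt j) b)"
  using assms(5) dif_swap_gt[OF assms(1,2)] unfolding adj'_cells_iff[OF assms(1-4)] by auto

lemma adj'_far:
  assumes "i < m" "j < m" "a \<in> {1, 2}" "b \<in> {1, 2}" "dif i j = h"
  shows "adj' (v i a) (v j b) \<longleftrightarrow> adj (v i a) (v (nxt j) b)"
  using assms(5) dif_swap_gt[OF assms(1,2)] h_pos unfolding adj'_cells_iff[OF assms(1-4)] by auto

lemma adj'_same:
  assumes "i < m" "a \<in> {1, 2}" "b \<in> {1, 2}"
  shows "\<not> adj' (v i a) (v i b)"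
  using assms h_pos unfolding adj'_cells_iff[OF assms(1,1,2,3)] by auto


lemma perm_prv: "i < m \<Longrightarrow> a \<in> {1, 2} \<Longrightarrow> \<pi> (v i a) = v (prv i) a"
  using perm by (simp add: prv_def)

text \<open>As \<pi> steps back by one cell, a new edge to cell \<open>i\<close> comes from an old
  edge to cell \<open>nxt i\<close>, in accordance with \<open>rot\<close>.\<close>

lemma in_new_D_iff:
  assumes "i < m" "a \<in> {1, 2}"
  shows "(x, v i a) \<in> new_D \<longleftrightarrow> x \<in> S \<and> adj x (v (nxt i) a)" (is "?L \<longleftrightarrow> ?R")
proof
  assume ?L
  then obtain w where w: "x \<in> S" "w \<in> cells m v" "adj x w" "v i a = \<pi> w"
    unfolding new_D_def adj_def by blast
  from w(2) obtain j b where j: "j < m" "b \<in> {1, 2}" "w = v j b"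
    by (rule cellsE)
  then have "i = prv j" "a = b" using w(4) assms by (simp_all add: perm_prv)
  then show ?R using w j by simp
next
  assume ?R
  moreover have "v i a = \<pi> (v (nxt i) a)" "v (nxt i) a \<in> cells m v"
    using assms by (simp_all add: perm_prv)
  ultimately show ?L unfolding new_D_def adj_def by blast
qed

lemma perm_in_cells: "w \<in> cells m v \<Longrightarrow> \<pi> w \<in> cells m v"
  by (elim cellsE) (simp add: perm_prv)

lemma new_D_subset: "new_D \<subseteq> S \<times> cells m v"
  by (auto simp: new_D_def perm_in_cells)

lemma cell_subset: "i < m \<Longrightarrow> cell v i \<subseteq> cells m v"
  by (auto simp: cells_def)

lemma cell_pairs_subset: "cell_pairs \<subseteq> cells m v \<times> cells m v"
proof -
  have "cell v ((i + d) mod m) \<subseteq> cells m v" for i d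
    using m_pos by (intro cell_subset) simp
  then show ?thesis using cell_subset unfolding cell_pairs_def by blast
qed

lemma new_near_subset: "new_near \<subseteq> cells m v \<times> cells m v"
  and new_far_subset: "new_far \<subseteq> cells m v \<times> cells m v"
  using m_pos by (auto simp: new_near_def new_far_def)

lemma adj'_outside:
  assumes "x \<in> D" "y \<in> D"
  shows "adj' x y \<longleftrightarrow> adj x y"
  using assms cells_D_disjoint new_D_subset cell_pairs_subset new_near_subset new_far_subset
  unfolding adj'_iff by blast

lemma adj'_outside_cell:
  assumes "x \<in> D" "i < m" "a \<in> {1, 2}"
  shows "adj' x (v i a) \<longleftrightarrow> (if x \<in> S then adj x (v (nxt i) a) else adj x (v i a))"
proof -
  have "x \<notin> cells m v" "v i a \<in> cells m v" "v i a \<notin> S"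
    using assms cells_D_disjoint S_subset v_notin_D by auto
  then have "(x, v i a) \<notin> cell_pairs" "(v i a, x) \<notin> new_D"
    "(x, v i a) \<notin> new_near" "(v i a, x) \<notin> new_near" "(x, v i a) \<notin> new_far" "(v i a, x) \<notin> new_far"
    using new_D_subset cell_pairs_subset new_near_subset new_far_subset by blast+
  then show ?thesis
    unfolding adj'_iff in_new_D_iff[OF assms(2,3)]
    using \<open>x \<notin> cells m v\<close> \<open>v i a \<in> cells m v\<close> \<open>v i a \<notin> S\<close> by simp
qed

section \<open>Comparison of the blocks of the two adjacency matrices\<close>

definition A :: "'a \<Rightarrow> 'a \<Rightarrow> real" where "A x y = of_bool (adj x y)"

definition A' :: "'a \<Rightarrow> 'a \<Rightarrow> real" where "A' x y = of_bool (adj' x y)"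

lemma A_sym: "A x y = A y x" and A'_sym: "A' x y = A' y x"
  by (simp_all add: A_def A'_def adj_sym adj'_sym)

lemma card_neighbours:
  assumes "i < m"
  shows "real (card (parcs G `` {x} \<inter> cell v i)) = A x (v i 1) + A x (v i 2)"
proof -
  have ne: "v i 1 \<noteq> v i 2" using assms by simp
  have "parcs G `` {x} \<inter> cell v i =
      (if adj x (v i 1) then {v i 1} else {}) \<union> (if adj x (v i 2) then {v i 2} else {})"
    by (auto simp: cell_def adj_def)
  with ne show ?thesis by (simp add: A_def)
qed

lemma in_S_iff:
  assumes "x \<in> D"
  shows "x \<in> S \<longleftrightarrow> (\<forall>i<m. A x (v i 1) + A x (v i 2) = 1)"
proof -
  have "card (parcs G `` {x} \<inter> cell v i) = 1 \<longleftrightarrow> A x (v i 1) + A x (v i 2) = 1" if "i < m" for i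
    using card_neighbours[OF that, of x] by linarith
  then show ?thesis using assms by (simp add: S_def one_neighbour_vertices_def)
qed

text \<open>Different values mean exactly one neighbour in cell \<open>i\<close>. By parity the
  number is then odd in every cell, and being at most 2 it is 1, which would put \<open>x\<close>
  into \<open>S\<close>.\<close>

lemma alternating_outside_S:
  assumes "x \<in> D" "x \<notin> S" "i < m"
  shows "A x (v i 1) = A x (v i 2)"
proof (rule ccontr)
  assume "A x (v i 1) \<noteq> A x (v i 2)"
  then have "real (card (parcs G `` {x} \<inter> cell v i)) = 1"
    unfolding card_neighbours[OF assms(3)] by (auto simp: A_def)
  then have i: "card (parcs G `` {x} \<inter> cell v i) = 1" by simp
  have "A x (v j 1) + A x (v j 2) = 1" if "j < m" for j
  proof -
    have "odd (card (parcs G `` {x} \<inter> cell v j))"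
      using parity[OF assms(1,3) that] i by (simp add: cong_def odd_iff_mod_2_eq_one)
    \<comment> \<open>Monotonicity of \<open>card\<close> needs a finite cell: an infinite one would
      have the default cardinality 0 instead of 2.\<close>
    moreover have "card (parcs G `` {x} \<inter> cell v j) \<le> 2"
      using card_cell[OF that] by (metis card_mono card.infinite Int_lower2 zero_neq_numeral)
    ultimately have "card (parcs G `` {x} \<inter> cell v j) = 1"
      by (cases "card (parcs G `` {x} \<inter> cell v j) = 2") (auto elim!: oddE)
    then show ?thesis using card_neighbours[OF that, of x] by simp
  qed
  then show False using assms in_S_iff by blast
qed

lemma total_sym: "total A i j = total A j i" "total A' i j = total A' j i"
  using A_sym A'_sym by (simp_all add: total_def)

lemma alt_both_sym: "alt_both A i j = alt_both A j i" "alt_both A' i j = alt_both A' j i"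
  using A_sym[of "v i _"] A'_sym[of "v i _"] by (simp_all add: alt_both_def)

text \<open>For different cells one of the two differences lies between 1 and h, because their sum
  is 2h + 1.\<close>

lemma dif_cases:
  assumes "i < m" "j < m"
  obtains (same) "i = j" | (near) "dif i j \<in> {1..<h}" | (far) "dif i j = h"
    | (near_rev) "dif j i \<in> {1..<h}" | (far_rev) "dif j i = h"
proof (cases "i = j")
  case False
  then have "dif i j > 0" "dif j i = m - dif i j" "dif i j < m"
    using dif_eq_0_iff[OF assms] dif_swap[OF assms] dif_less by auto
  then show ?thesis
    using m_eq near far near_rev far_rev unfolding atLeastLessThan_iff by linarith
qed

text \<open>A perfect matching and a full row of a 2x2 block both consist of two edges.\<close>

lemma total_A:
  assumes "i < m" "j < m"
  shows "total A i j = (if i = j then 0 else 2)"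
  using assms
proof (cases rule: dif_cases)
  case same
  then show ?thesis using cell_edgeless[OF assms(1)] by (simp add: total_def A_def)
next
  case near
  then have "i \<noteq> j" by auto
  with near_adj[OF assms near] show ?thesis by (auto simp: total_def A_def)
next
  case far
  then have "i \<noteq> j" using h_pos by auto
  with far_adj[OF assms far] show ?thesis by (auto simp: total_def A_def)
next
  case near_rev
  then have "i \<noteq> j" by auto
  with near_adj[OF assms(2,1) near_rev] show ?thesis
    unfolding total_sym(1)[of i j] by (auto simp: total_def A_def)
next
  case far_rev
  then have "i \<noteq> j" using h_pos by auto
  with far_adj[OF assms(2,1) far_rev] show ?thesis
    unfolding total_sym(1)[of i j] by (auto simp: total_def A_def)
qed

text \<open>A far block is constant in the label of its second cell, so alternating over that label
  gives 0.\<close>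

lemma alt_both_A_eq_0:
  assumes "i < m" "j < m" "dif i j = 0 \<or> dif i j = h \<or> dif j i = h"
  shows "alt_both A i j = 0"
proof -
  consider "i = j" | "dif i j = h" | "dif j i = h"
    using assms dif_eq_0_iff by blast
  then show ?thesis
  proof cases
    case 1
    then show ?thesis using cell_edgeless[OF assms(1)] by (simp add: alt_both_def A_def)
  next
    case 2
    show ?thesis using far_adj[OF assms(1,2) 2] by (auto simp: alt_both_def A_def)
  next
    case 3
    show ?thesis unfolding alt_both_sym(1)[of i j]
      using far_adj[OF assms(2,1) 3] by (auto simp: alt_both_def A_def)
  qed
qed

text \<open>In a near block, and in a far block read from its second cell, both row sums are 1. Only
  a far block in its own direction distinguishes the rows.\<close>

lemma alt_row_A_eq_0:
  assumes "i < m" "j < m" "dif i j \<noteq> h"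
  shows "alt_row A i j = 0"
  using assms(1,2)
proof (cases rule: dif_cases)
  case same
  then show ?thesis using cell_edgeless[OF assms(1)] by (simp add: alt_row_def A_def)
next
  case near
  then show ?thesis using near_adj[OF assms(1,2) near] by (auto simp: alt_row_def A_def)
next
  case far
  then show ?thesis using assms by simp
next
  case near_rev
  then show ?thesis using near_adj[OF assms(2,1) near_rev]
    by (auto simp: alt_row_def A_sym[of "v i _"]) (auto simp: A_def)
next
  case far_rev
  then show ?thesis using far_adj[OF assms(2,1) far_rev]
    by (auto simp: alt_row_def A_sym[of "v i _"]) (auto simp: A_def)
qed

lemma A'_near:
  assumes "i < m" "j < m" "dif i j \<in> {1..<h}" "a \<in> {1, 2}" "b \<in> {1, 2}"
  shows "A' (v i a) (v j b) = A (v (nxt i) a) (v (nxt j) b)"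
  using assms by (simp add: A_def A'_def adj'_near)

lemma A'_far:
  assumes "i < m" "j < m" "dif i j = h" "a \<in> {1, 2}" "b \<in> {1, 2}"
  shows "A' (v i a) (v j b) = A (v i a) (v (nxt j) b)"
  using assms by (simp add: A_def A'_def adj'_far)

lemma A'_same: "i < m \<Longrightarrow> a \<in> {1, 2} \<Longrightarrow> b \<in> {1, 2} \<Longrightarrow> A' (v i a) (v i b) = 0"
  by (simp add: A'_def adj'_same)

text \<open>The new far block at (i, j) is copied from (i, j + 1), which is an old far block read
  backwards: there cell j + 1 comes first.\<close>

lemma dif_nxt_far:
  assumes "i < m" "j < m" "dif i j = h"
  shows "dif i (nxt j) = h + 1" "dif (nxt j) i = h"
proof -
  \<comment> \<open>The difference does not wrap around to 0, as h = m - 1 = 2h is impossible for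
    positive h.\<close>
  show *: "dif i (nxt j) = h + 1"
    using dif_nxt_right[OF assms(1,2)] assms h_pos m_eq by simp
  then have "i \<noteq> nxt j" by auto
  then show "dif (nxt j) i = h"
    using dif_swap[of i "nxt j", OF assms(1) nxt_less[OF assms(2)]] * m_eq by linarith
qed

text \<open>One direction of each pair suffices here; \<open>total_A'\<close> obtains the other from
  the symmetry of the total.\<close>

lemma total_A'_dif_le:
  assumes "i < m" "j < m"
  shows "i = j \<or> dif i j \<in> {1..<h} \<or> dif i j = h \<Longrightarrow> total A' i j = (if i = j then 0 else 2)"
proof (elim disjE)
  assume "i = j"
  then show ?thesis using assms by (simp add: total_def A'_same)
next
  assume *: "dif i j \<in> {1..<h}"
  then have "total A' i j = total A (nxt i) (nxt j)" "i \<noteq> j"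
    using assms by (auto simp: total_def A'_near)
  then show ?thesis using assms total_A nxt_eq_iff by simp
next
  assume *: "dif i j = h"
  then have "total A' i j = total A i (nxt j)" "i \<noteq> j"
    using assms h_pos by (auto simp: total_def A'_far)
  moreover have "i \<noteq> nxt j" using dif_nxt_far(1)[OF assms *] by auto
  ultimately show ?thesis using assms total_A by simp
qed

lemma total_A':
  assumes "i < m" "j < m"
  shows "total A' i j = total A i j"
  unfolding total_A[OF assms] using assms
  by (cases rule: dif_cases)
    (use total_A'_dif_le[OF assms] total_A'_dif_le[OF assms(2,1)] total_sym(2)[of i j] in auto)

text \<open>For near pairs this is how the new block was defined. For far pairs both sides vanish:
  the left one is copied from a reversed far block, and (i + 1, j + 1) is again far.\<close>

lemma alt_both_A'_dif_le:
  assumes "i < m" "j < m" and c: "i = j \<or> dif i j \<in> {1..<h} \<or> dif i j = h"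
  shows "alt_both A' i j = alt_both A (nxt i) (nxt j)"
  using c
proof (elim disjE)
  assume "i = j"
  then show ?thesis using assms alt_both_A_eq_0[of "nxt i" "nxt i"]
    by (simp add: alt_both_def A'_same)
next
  assume *: "dif i j \<in> {1..<h}"
  then show ?thesis using assms by (simp add: alt_both_def A'_near)
next
  assume *: "dif i j = h"
  then have "alt_both A' i j = alt_both A i (nxt j)"
    using assms by (simp add: alt_both_def A'_far)
  also have "\<dots> = 0"
    using assms dif_nxt_far[OF assms(1,2) *] by (intro alt_both_A_eq_0) auto
  also have "\<dots> = alt_both A (nxt i) (nxt j)"
    using assms * by (intro alt_both_A_eq_0[symmetric]) (auto simp: dif_nxt_nxt)
  finally show ?thesis .
qed

lemma alt_both_A':
  assumes "i < m" "j < m"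
  shows "alt_both A' i j = alt_both A (nxt i) (nxt j)"
  using assms
  by (cases rule: dif_cases)
    (use alt_both_A'_dif_le[OF assms] alt_both_A'_dif_le[OF assms(2,1)]
      alt_both_sym(2)[of i j] alt_both_sym(1)[of "nxt i" "nxt j"] in auto)

text \<open>Excluding the differences h and h + 1 means that neither (i + 1, j + 1) nor (i + 1, j)
  is a far pair in its own direction.\<close>

lemma alt_row_A_nxt_eq_0:
  assumes "i < m" "j < m" "i \<noteq> j" "dif i j \<noteq> h" "dif i j - 1 \<noteq> h"
  shows "alt_row A (nxt i) (nxt j) = 0" "alt_row A (nxt i) j = 0"
proof -
  show "alt_row A (nxt i) (nxt j) = 0"
    using assms by (intro alt_row_A_eq_0) (simp_all add: dif_nxt_nxt)
  show "alt_row A (nxt i) j = 0"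
    using assms by (intro alt_row_A_eq_0) (simp_all add: dif_nxt_left)
qed

text \<open>This entry is not symmetric in the two cells, so both directions are treated. If i = j +
  h, both sides read the same old block, between j and i + 1; in all other cases both sides are
  0.\<close>

lemma alt_row_A':
  assumes "i < m" "j < m"
  shows "alt_row A' i j = alt_row A (nxt i) j"
  using assms
proof (cases rule: dif_cases)
  case same
  \<comment> \<open>The right side belongs to (i + 1, i), whose difference is m - 1 = 2h.\<close>
  have "m - 1 \<noteq> h" using m_eq h_pos by simp
  with same show ?thesis
    using assms by (subst alt_row_A_eq_0) (auto simp: alt_row_def A'_same dif_nxt_left)
next
  case near
  then have "dif i j \<noteq> h" "i \<noteq> j" "dif i j - 1 \<noteq> h" by auto
  moreover have "alt_row A' i j = alt_row A (nxt i) (nxt j)"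
    using near assms by (simp add: alt_row_def A'_near)
  ultimately show ?thesis
    using assms by (simp add: alt_row_A_nxt_eq_0)
next
  case far
  then have "i \<noteq> j" "dif i j - 1 \<noteq> h" using h_pos by auto
  moreover have "alt_row A' i j = alt_row A i (nxt j)"
    using far assms by (simp add: alt_row_def A'_far)
  ultimately show ?thesis
    using assms dif_nxt_far[OF assms far] by (simp add: alt_row_A_eq_0 dif_nxt_left)
next
  case near_rev
  then have ne: "i \<noteq> j" by auto
  \<comment> \<open>The reverse difference is at most h - 1, so this one is at least h + 2.\<close>
  then have "dif i j - 1 \<noteq> h" "dif i j \<noteq> h"
    using near_rev dif_swap[of i j] dif_swap[of j i] assms m_eq by auto
  moreover have "alt_row A' i j = alt_row A (nxt i) (nxt j)"
    using near_rev assms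
    by (simp add: alt_row_def A'_sym[of "v i _"] A'_near A_sym[of "v (nxt i) _"])
  ultimately show ?thesis
    using assms ne by (simp add: alt_row_A_nxt_eq_0)
next
  case far_rev
  then show ?thesis
    using assms by (simp add: alt_row_def A'_sym[of "v i _"] A'_far A_sym[of "v (nxt i) _"])
qed

section \<open>Cospectrality and simplicity of the switched graph\<close>

lemma rot_intertwines_adjacency:
  assumes "x \<in> cells m v \<union> D" "z \<in> cells m v \<union> D"
  shows "(\<Sum>y\<in>cells m v \<union> D. rot x y * A y z) = (\<Sum>y\<in>cells m v \<union> D. A' x y * rot y z)"
proof (rule rot_intertwines[OF A_sym A'_sym total_A' alt_row_A' alt_both_A' _ _ _ assms])
  show "A' x y = A x y" if "x \<in> D" "y \<in> D" for x y
    using that by (simp add: A_def A'_def adj'_outside)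
  have A'_D: "A' x (v i a) = (if x \<in> S then A x (v (nxt i) a) else A x (v i a))"
    if "x \<in> D" "i < m" "a \<in> {1, 2}" for x i a
    using that by (simp add: A_def A'_def adj'_outside_cell)
  \<comment> \<open>For \<open>x\<close> in \<open>S\<close> both sums are 1; otherwise the row of
    \<open>x\<close> is unchanged on the cells.\<close>
  show "A' x (v i 1) + A' x (v i 2) = A x (v i 1) + A x (v i 2)" if "x \<in> D" "i < m" for x i
    using that in_S_iff[OF that(1)] nxt_less[OF that(2)] by (cases "x \<in> S") (simp_all add: A'_D)
  \<comment> \<open>For \<open>x\<close> in \<open>S\<close> this is the shift by \<pi>; otherwise
    both differences are 0, since \<open>x\<close> sees each cell constantly.\<close>
  show "A' x (v i 1) - A' x (v i 2) = A x (v (nxt i) 1) - A x (v (nxt i) 2)"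
    if "x \<in> D" "i < m" for x i
    using that alternating_outside_S[OF that(1)] by (cases "x \<in> S") (simp_all add: A'_D)
qed

lemma spectrum_mset_eq:
  assumes "distinct vs" "set vs = cells m v \<union> D" "distinct ws" "set ws = cells m v \<union> D"
  shows "spectrum_mset (adjacency_mat H ws + r \<cdot>\<^sub>m ones_mat (length ws)) =
    spectrum_mset (adjacency_mat G vs + r \<cdot>\<^sub>m ones_mat (length vs))"
proof -
  have G: "adjacency_mat G vs + r \<cdot>\<^sub>m ones_mat (length vs) =
    mat (length vs) (length vs) (\<lambda>(i, j). A (vs ! i) (vs ! j) + r)" for vs
    by (rule eq_matI) (auto simp: adjacency_mat_def ones_mat_def A_def adj_def)
  have H: "adjacency_mat H ws + r \<cdot>\<^sub>m ones_mat (length ws) =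
    mat (length ws) (length ws) (\<lambda>(i, j). A' (ws ! i) (ws ! j) + r)" for ws
    by (rule eq_matI) (auto simp: adjacency_mat_def ones_mat_def A'_def adj'_def)
  have "char_poly (adjacency_mat H ws + r \<cdot>\<^sub>m ones_mat (length ws)) =
    char_poly (adjacency_mat G vs + r \<cdot>\<^sub>m ones_mat (length vs))"
    unfolding G H
  proof (rule char_poly_eq_of_intertwining[OF assms, where q = rot])
    fix x z assume "x \<in> cells m v \<union> D" "z \<in> cells m v \<union> D"
    then show "(\<Sum>y\<in>cells m v \<union> D. rot x y * rot z y) = (if x = z then 1 else 0)"
      "(\<Sum>y\<in>cells m v \<union> D. rot x y * (A y z + r)) = (\<Sum>y\<in>cells m v \<union> D. (A' x y + r) * rot y z)"
      \<comment> \<open>By the row and column sums, the terms with \<open>r\<close> contribute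
        \<open>r\<close> on either side.\<close>
      using rot_orthogonal rot_intertwines_adjacency rot_row_sum rot_col_sum
      by (simp_all add: distrib_left distrib_right sum.distrib flip: sum_distrib_left sum_distrib_right)
  qed
  moreover have "adjacency_mat G vs + r \<cdot>\<^sub>m ones_mat (length vs) \<in> carrier_mat (length vs) (length vs)"
    "adjacency_mat H ws + r \<cdot>\<^sub>m ones_mat (length ws) \<in> carrier_mat (length ws) (length ws)"
    unfolding G H by simp_all
  \<comment> \<open>The complex characteristic polynomials are the images of the equal real
    ones.\<close>
  ultimately show ?thesis
    unfolding spectrum_mset_def by (simp add: of_real_hom.char_poly_hom)
qed

lemma cospectral: "R_cospectral H G"
  unfolding R_cospectral_def pverts_H pverts_G using spectrum_mset_eq by blast

text \<open>A loop at a cell vertex would need difference 0, whereas inserted edges between cells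
  have differences from 1 to h; within \<open>D\<close> nothing changes.\<close>

lemma pair_graph_H: "pair_graph H"
proof -
  interpret pair_graph G by (rule pair_graph_G)
  have V: "x \<in> cells m v \<union> D" "y \<in> cells m v \<union> D" if "adj' x y" for x y
    using that adj_verts[of x y] new_D_subset S_subset new_near_subset new_far_subset
    unfolding adj'_iff by blast+
  have irrefl: "\<not> adj' x x" for x
  proof
    assume "adj' x x"
    from V(1)[OF this] show False
    proof (cases rule: vertex_cases)
      case (cell i a)
      then show False using \<open>adj' x x\<close> adj'_same[of i a a] by simp
    next
      case outside
      then show False using \<open>adj' x x\<close> adj'_outside[of x x] adj_irrefl by simp
    qed
  qed
  have fin: "finite (pverts H)" "finite (parcs H)"
  proof -
    show "finite (pverts H)" by (simp add: pverts_H finite_cells finite_D)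
    moreover have "parcs H \<subseteq> pverts H \<times> pverts H"
      using V by (auto simp: adj'_def pverts_H)
    ultimately show "finite (parcs H)"
      by (meson finite_SigmaI finite_subset)
  qed
  show ?thesis
  proof
    show "fst e \<in> pverts H" "snd e \<in> pverts H" if "e \<in> parcs H" for e
      using that V[of "fst e" "snd e"] by (simp_all add: adj'_def pverts_H)
    show "finite (pverts H)" "finite (parcs H)" by (fact fin)+
    show "fst e \<noteq> snd e" if "e \<in> parcs H" for e
      using that irrefl[of "fst e"] unfolding adj'_def by (metis prod.collapse)
    show "symmetric (with_proj H)"
      unfolding symmetric_def using adj'_sym by (auto simp: adj'_def intro!: symI)
  qed
qed

end

theorem theorem7:
  fixes G :: "'a pair_pre_digraph"
    and m :: nat
    and v :: "nat \<Rightarrow> nat \<Rightarrow> 'a"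
    and D :: "'a set"
    and \<pi> :: "'a \<Rightarrow> 'a"
  assumes "m \<ge> 3" and "odd m"
    and "pair_graph G"
    and "pverts G = cells m v \<union> D"
    and "cells m v \<inter> D = {}"
    and "disjoint_family_on (cell v) {..<m}"
    and "\<forall>i<m. card (cell v i) = 2"
    and "\<forall>x\<in>D. \<forall>i<m. \<forall>j<m.
           [card (parcs G `` {x} \<inter> cell v i) = card (parcs G `` {x} \<inter> cell v j)] (mod 2)"
    and "\<forall>i<m. \<forall>d\<in>{1..(m - 3) div 2}. let j = (i + d) mod m in
           arcs (with_proj G \<restriction> (cell v i \<union> cell v j)) = symcl {(v i 1, v j 1), (v i 2, v j 2)} \<or>
           arcs (with_proj G \<restriction> (cell v i \<union> cell v j)) = symcl {(v i 1, v j 2), (v i 2, v j 1)}"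
    and "\<forall>i<m. let j = (i + (m - 1) div 2) mod m in
           arcs (with_proj G \<restriction> (cell v i \<union> cell v j)) = symcl {(v i 1, v j 1), (v i 1, v j 2)} \<or>
           arcs (with_proj G \<restriction> (cell v i \<union> cell v j)) = symcl {(v i 2, v j 1), (v i 2, v j 2)}"
    and "bij_betw \<pi> (cells m v) (cells m v)"
    and "\<forall>i<m. \<forall>a\<in>{1, 2}. \<pi> (v i a) = v ((i + m - 1) mod m) a"
  shows "pair_graph (switched_graph m v D \<pi> G) \<and> R_cospectral (switched_graph m v D \<pi> G) G"
proof -
  define h where "h = (m - 1) div 2"
  have h: "h \<ge> 1" "m = 2 * h + 1" "(m - 3) div 2 = h - 1"
    using assms(1,2) by (auto simp: h_def elim!: oddE)
  interpret G: pair_graph G by (rule assms(3))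
  have "finite D"
    using G.pair_finite_verts assms(4) by simp
  interpret odd_switching m v D G \<pi> h
  proof unfold_locales
    fix i d j :: nat assume *: "i < m" "d \<in> {1..<h}" "j = (i + d) mod m"
    then have "d \<in> {1..(m - 3) div 2}" using h by auto
    with * show "arcs (with_proj G \<restriction> (cell v i \<union> cell v j)) = symcl {(v i 1, v j 1), (v i 2, v j 2)} \<or>
      arcs (with_proj G \<restriction> (cell v i \<union> cell v j)) = symcl {(v i 1, v j 2), (v i 2, v j 1)}"
      using assms(9) unfolding Let_def by blast
  next
    fix i j :: nat assume *: "i < m" "j = (i + h) mod m"
    then show "arcs (with_proj G \<restriction> (cell v i \<union> cell v j)) = symcl {(v i 1, v j 1), (v i 1, v j 2)} \<or>
      arcs (with_proj G \<restriction> (cell v i \<union> cell v j)) = symcl {(v i 2, v j 1), (v i 2, v j 2)}"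
      using assms(10) unfolding Let_def h_def by blast
  qed (use assms h \<open>finite D\<close> in blast)+
  show ?thesis
    using pair_graph_H cospectral unfolding H_def by blast
qed

end
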